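(* Let $M$ be an infinite metric space with an isolated point. Then, for every Lipschitz map $f\colon M\to M$ and every $e\in M$, the operator $T_{f,e}\colon\mathcal F(M,e)\to\mathcal F(M,e)$ has a non-trivial invariant subspace.
   Context: $\mathbb K$ denotes $\mathbb R$ or $\mathbb C$. For a metric space $M$ and $e\in M$, $\mathrm{Lip}_0(M,e)$ is the Banach space of Lipschitz functions $\varphi\colon M\to\mathbb K$ with $\varphi(e)=0$, normed by the best Lipschitz constant. For $x\in M$, $\delta(x)=\delta_e(x)\in \mathrm{Lip}_0(M,e)^*$ is the evaluation functional $\varphi\mapsto\varphi(x)$. The Lipschitz-free space with basepoint $e$ is $\mathcal F(M,e):=\overline{\mathrm{span}}\{\delta(x):x\in M\}\subset \mathrm{Lip}_0(M,e)^*$ (norm closure). For a Lipschitz map $f\colon M\to M$ (not assumed to fix $e$), $T_{f,e}\colon\mathcal F(M,e)\to\mathcal F(M,e)$ is the unique bounded linear operator with $T_{f,e}(\delta(x))=\delta(f(x))-\delta(f(e))$ for all $x\in M$. A non-trivial invariant subspace of a bounded operator $T\colon X\to X$ is a closed linear subspace $S$ with $\{0\}\subsetneq S\subsetneq X$ and $T(S)\subset S$. *)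

theory Defs
  imports "HOL-Analysis.Analysis" "HOL-Library.Function_Algebras"
begin

text \<open>
  The scalar field is a type \<open>'k\<close> of class \<^class>\<open>real_normed_field\<close>, to be instantiated with
  \<^typ>\<open>real\<close> or \<^typ>\<open>complex\<close>. The space of functions depends on the base point \<open>e\<close>, so normed
  spaces are carrier sets of functions with the pointwise operations.
\<close>

abbreviation (input) scale_fun :: "'k::field \<Rightarrow> ('b \<Rightarrow> 'k) \<Rightarrow> ('b \<Rightarrow> 'k)"
  where "scale_fun c F \<equiv> (\<lambda>x. c * F x)"

interpretation fun_space: vector_space "scale_fun :: 'k::field \<Rightarrow> ('b \<Rightarrow> 'k) \<Rightarrow> ('b \<Rightarrow> 'k)"
  by unfold_locales (auto simp: fun_eq_iff algebra_simps)

definition Lip0 :: "'a::metric_space \<Rightarrow> ('a \<Rightarrow> 'k::real_normed_field) set"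
  where "Lip0 e = {\<phi>. (\<exists>L. L-lipschitz_on UNIV \<phi>) \<and> \<phi> e = 0}"

definition lip_norm :: "('a::metric_space \<Rightarrow> 'k::real_normed_field) \<Rightarrow> real"
  where "lip_norm \<phi> = Inf {L. L-lipschitz_on UNIV \<phi>}"

text \<open>
  Functionals on \<open>Lip0 e\<close> are represented by total functions that vanish outside \<open>Lip0 e\<close>;
  this makes the representation unique and compatible with the pointwise operations.
\<close>

definition Lip0_dual :: "'a::metric_space \<Rightarrow> (('a \<Rightarrow> 'k::real_normed_field) \<Rightarrow> 'k) set"
  where "Lip0_dual e = {\<Phi>.
    (\<forall>\<phi>\<in>Lip0 e. \<forall>\<psi>\<in>Lip0 e. \<Phi> (\<phi> + \<psi>) = \<Phi> \<phi> + \<Phi> \<psi>) \<and>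
    (\<forall>c. \<forall>\<phi>\<in>Lip0 e. \<Phi> (scale_fun c \<phi>) = c * \<Phi> \<phi>) \<and>
    (\<exists>C. \<forall>\<phi>\<in>Lip0 e. norm (\<Phi> \<phi>) \<le> C * lip_norm \<phi>) \<and>
    (\<forall>\<phi>. \<phi> \<notin> Lip0 e \<longrightarrow> \<Phi> \<phi> = 0)}"

definition dual_norm :: "'a::metric_space \<Rightarrow> (('a \<Rightarrow> 'k::real_normed_field) \<Rightarrow> 'k) \<Rightarrow> real"
  where "dual_norm e \<Phi> = (SUP \<phi> \<in> {\<phi> \<in> Lip0 e. lip_norm \<phi> \<le> 1}. norm (\<Phi> \<phi>))"

text \<open>
  The axioms of \<^locale>\<open>Metric_space\<close> constrain the distance outside the carrier as well
  (there it must be nonnegative), so it is set to 0 there.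
\<close>

definition dual_dist ::
  "'a::metric_space \<Rightarrow> (('a \<Rightarrow> 'k::real_normed_field) \<Rightarrow> 'k) \<Rightarrow> (('a \<Rightarrow> 'k) \<Rightarrow> 'k) \<Rightarrow> real"
  where "dual_dist e \<Phi> \<Psi> =
    (if \<Phi> \<in> Lip0_dual e \<and> \<Psi> \<in> Lip0_dual e then dual_norm e (\<Phi> - \<Psi>) else 0)"

definition dual_topology :: "'a::metric_space \<Rightarrow> (('a \<Rightarrow> 'k::real_normed_field) \<Rightarrow> 'k) topology"
  where "dual_topology e = Metric_space.mtopology (Lip0_dual e) (dual_dist e)"

definition eval_at :: "'a::metric_space \<Rightarrow> 'a \<Rightarrow> (('a \<Rightarrow> 'k::real_normed_field) \<Rightarrow> 'k)"
  where "eval_at e x = (\<lambda>\<phi>. if \<phi> \<in> Lip0 e then \<phi> x else 0)"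

definition lip_free :: "'a::metric_space \<Rightarrow> (('a \<Rightarrow> 'k::real_normed_field) \<Rightarrow> 'k) set"
  where "lip_free e = dual_topology e closure_of (fun_space.span (range (eval_at e)))"

definition bounded_operator ::
  "'a::metric_space \<Rightarrow> ((('a \<Rightarrow> 'k::real_normed_field) \<Rightarrow> 'k) \<Rightarrow> (('a \<Rightarrow> 'k) \<Rightarrow> 'k)) \<Rightarrow> bool"
  where "bounded_operator e T \<longleftrightarrow>
    T \<in> lip_free e \<rightarrow> lip_free e \<and>
    (\<forall>\<Phi>\<in>lip_free e. \<forall>\<Psi>\<in>lip_free e. T (\<Phi> + \<Psi>) = T \<Phi> + T \<Psi>) \<and>
    (\<forall>c. \<forall>\<Phi>\<in>lip_free e. T (scale_fun c \<Phi>) = scale_fun c (T \<Phi>)) \<and>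
    (\<exists>C. \<forall>\<Phi>\<in>lip_free e. dual_norm e (T \<Phi>) \<le> C * dual_norm e \<Phi>)"

text \<open>
  Extensionality only fixes the irrelevant values outside \<open>lip_free e\<close>. Existence and
  uniqueness of the operator for Lipschitz \<open>f\<close> are proved in \<open>lip_free_op_ex1\<close> below.
\<close>

definition lip_free_op :: "('a::metric_space \<Rightarrow> 'a) \<Rightarrow> 'a \<Rightarrow>
    (('a \<Rightarrow> 'k::real_normed_field) \<Rightarrow> 'k) \<Rightarrow> (('a \<Rightarrow> 'k) \<Rightarrow> 'k)"
  where "lip_free_op f e = (THE T. T \<in> extensional (lip_free e) \<and> bounded_operator e T \<and>
    (\<forall>x. T (eval_at e x) = eval_at e (f x) - eval_at e (f e)))"

definition nontrivial_invariant_subspace ::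
  "'a::metric_space \<Rightarrow> ((('a \<Rightarrow> 'k::real_normed_field) \<Rightarrow> 'k) \<Rightarrow> (('a \<Rightarrow> 'k) \<Rightarrow> 'k)) \<Rightarrow>
    (('a \<Rightarrow> 'k) \<Rightarrow> 'k) set \<Rightarrow> bool"
  where "nontrivial_invariant_subspace e T S \<longleftrightarrow>
    fun_space.subspace S \<and> closedin (subtopology (dual_topology e) (lip_free e)) S \<and>
    {0} \<subset> S \<and> S \<subset> lip_free e \<and> T ` S \<subseteq> S"


subsection \<open>Well-definedness\<close>

lemma lip_norm_le: "L-lipschitz_on UNIV \<phi> \<Longrightarrow> lip_norm \<phi> \<le> L"
  unfolding lip_norm_def
  by (rule cInf_lower) (auto intro!: bdd_belowI[of _ 0] dest: lipschitz_on_nonneg)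

lemma lip_norm_nonneg: "\<phi> \<in> Lip0 e \<Longrightarrow> 0 \<le> lip_norm \<phi>"
  unfolding lip_norm_def Lip0_def
  by (rule cInf_greatest) (auto dest: lipschitz_on_nonneg)

lemma lip_norm_lipschitz:
  assumes "\<phi> \<in> Lip0 e"
  shows "(lip_norm \<phi>)-lipschitz_on UNIV \<phi>"
proof (rule lipschitz_onI)
  fix x y
  show "dist (\<phi> x) (\<phi> y) \<le> lip_norm \<phi> * dist x y"
  proof (cases "x = y")
    case False
    have "dist (\<phi> x) (\<phi> y) / dist x y \<le> lip_norm \<phi>"
      unfolding lip_norm_def
    proof (rule cInf_greatest)
      show "{L. L-lipschitz_on UNIV \<phi>} \<noteq> {}"
        using assms by (auto simp: Lip0_def)
      show "dist (\<phi> x) (\<phi> y) / dist x y \<le> L" if "L \<in> {L. L-lipschitz_on UNIV \<phi>}" for L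
        using that False lipschitz_onD[of L UNIV \<phi> x y] by (simp add: divide_le_eq)
    qed
    with False show ?thesis by (simp add: divide_le_eq)
  qed simp
qed (use assms lip_norm_nonneg in blast)

lemma zero_lipschitz: "0-lipschitz_on UNIV (0 :: 'a::metric_space \<Rightarrow> 'k::real_normed_field)"
  by (auto simp: lipschitz_on_def)

lemma Lip0_zero: "0 \<in> Lip0 e"
  using zero_lipschitz by (auto simp: Lip0_def)

lemma lip_norm_zero: "lip_norm 0 = 0"
  using lip_norm_le[OF zero_lipschitz] lip_norm_nonneg[OF Lip0_zero] by (rule antisym)

lemma Lip0_add: "\<phi> \<in> Lip0 e \<Longrightarrow> \<psi> \<in> Lip0 e \<Longrightarrow> \<phi> + \<psi> \<in> Lip0 e"
  unfolding Lip0_def plus_fun_def by (auto intro: lipschitz_on_add)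

lemma lipschitz_on_scale_fun:
  fixes \<phi> :: "'a::metric_space \<Rightarrow> 'k::real_normed_field"
  shows "L-lipschitz_on UNIV \<phi> \<Longrightarrow> (norm c * L)-lipschitz_on UNIV (scale_fun c \<phi>)"
  unfolding lipschitz_on_def
  by (simp add: dist_norm mult.assoc mult_left_mono norm_mult flip: right_diff_distrib)

lemma Lip0_scale: "\<phi> \<in> Lip0 e \<Longrightarrow> scale_fun c \<phi> \<in> Lip0 e"
  unfolding Lip0_def using lipschitz_on_scale_fun by fastforce

lemma lip_norm_scale_le: "\<phi> \<in> Lip0 e \<Longrightarrow> lip_norm (scale_fun c \<phi>) \<le> norm c * lip_norm \<phi>"
  by (intro lip_norm_le lipschitz_on_scale_fun lip_norm_lipschitz)

lemma dual_add: "\<Phi> \<in> Lip0_dual e \<Longrightarrow> \<phi> \<in> Lip0 e \<Longrightarrow> \<psi> \<in> Lip0 e \<Longrightarrow> \<Phi> (\<phi> + \<psi>) = \<Phi> \<phi> + \<Phi> \<psi>"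
  by (auto simp: Lip0_dual_def)

lemma dual_scale: "\<Phi> \<in> Lip0_dual e \<Longrightarrow> \<phi> \<in> Lip0 e \<Longrightarrow> \<Phi> (scale_fun c \<phi>) = c * \<Phi> \<phi>"
  by (auto simp: Lip0_dual_def)

lemma dual_outside: "\<Phi> \<in> Lip0_dual e \<Longrightarrow> \<phi> \<notin> Lip0 e \<Longrightarrow> \<Phi> \<phi> = 0"
  by (auto simp: Lip0_dual_def)

lemma dual_bound:
  assumes "\<Phi> \<in> Lip0_dual e"
  obtains C where "C \<ge> 0" "\<And>\<phi>. \<phi> \<in> Lip0 e \<Longrightarrow> norm (\<Phi> \<phi>) \<le> C * lip_norm \<phi>"
proof -
  from assms obtain C where C: "\<And>\<phi>. \<phi> \<in> Lip0 e \<Longrightarrow> norm (\<Phi> \<phi>) \<le> C * lip_norm \<phi>"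
    unfolding Lip0_dual_def by blast
  have "norm (\<Phi> \<phi>) \<le> \<bar>C\<bar> * lip_norm \<phi>" if "\<phi> \<in> Lip0 e" for \<phi>
    using C[OF that] mult_right_mono[OF abs_ge_self[of C] lip_norm_nonneg[OF that]] by linarith
  then show ?thesis using that[of "\<bar>C\<bar>"] by auto
qed

lemma dual_norm_le:
  assumes "C \<ge> 0" "\<And>\<phi>. \<phi> \<in> Lip0 e \<Longrightarrow> norm (\<Phi> \<phi>) \<le> C * lip_norm \<phi>"
  shows "dual_norm e \<Phi> \<le> C"
  unfolding dual_norm_def
proof (rule cSUP_least)
  show "{\<phi> \<in> Lip0 e. lip_norm \<phi> \<le> 1} \<noteq> {}"
    by (auto intro!: exI[of _ 0] simp: Lip0_zero lip_norm_zero)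
  show "norm (\<Phi> \<phi>) \<le> C" if "\<phi> \<in> {\<phi> \<in> Lip0 e. lip_norm \<phi> \<le> 1}" for \<phi>
    using that assms(2)[of \<phi>] mult_left_mono[of "lip_norm \<phi>" 1 C] assms(1) by auto
qed

lemma dual_norm_ge:
  assumes "\<Phi> \<in> Lip0_dual e" "\<phi> \<in> Lip0 e" "lip_norm \<phi> \<le> 1"
  shows "norm (\<Phi> \<phi>) \<le> dual_norm e \<Phi>"
  unfolding dual_norm_def
proof (rule cSUP_upper)
  obtain C where C: "C \<ge> 0" "\<And>\<phi>. \<phi> \<in> Lip0 e \<Longrightarrow> norm (\<Phi> \<phi>) \<le> C * lip_norm \<phi>"
    using dual_bound[OF assms(1)] by blast
  show "bdd_above ((\<lambda>\<phi>. norm (\<Phi> \<phi>)) ` {\<phi> \<in> Lip0 e. lip_norm \<phi> \<le> 1})"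
  proof (rule bdd_aboveI2)
    show "norm (\<Phi> \<phi>) \<le> C" if "\<phi> \<in> {\<phi> \<in> Lip0 e. lip_norm \<phi> \<le> 1}" for \<phi>
      using that C(2)[of \<phi>] mult_left_mono[of "lip_norm \<phi>" 1 C] C(1) by auto
  qed
qed (use assms in auto)

lemma dual_norm_nonneg: "\<Phi> \<in> Lip0_dual e \<Longrightarrow> 0 \<le> dual_norm e \<Phi>"
  using dual_norm_ge[of \<Phi> e 0] Lip0_zero[of e] lip_norm_zero norm_ge_zero order_trans
  by (metis zero_le_one)

lemma dual_norm_bound:
  fixes \<Phi> :: "('a::metric_space \<Rightarrow> 'k::real_normed_field) \<Rightarrow> 'k"
  assumes \<Phi>: "\<Phi> \<in> Lip0_dual e" and \<phi>: "\<phi> \<in> Lip0 e"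
  shows "norm (\<Phi> \<phi>) \<le> dual_norm e \<Phi> * lip_norm \<phi>"
proof (cases "lip_norm \<phi> = 0")
  case True
  with dual_bound[OF \<Phi>] \<phi> show ?thesis by (metis mult_zero_right)
next
  case False
  with lip_norm_nonneg[OF \<phi>] have pos: "lip_norm \<phi> > 0" by simp
  let ?c = "of_real (inverse (lip_norm \<phi>)) :: 'k"
  have "lip_norm (scale_fun ?c \<phi>) \<le> 1"
    using lip_norm_scale_le[OF \<phi>, of ?c] pos by (simp del: of_real_inverse)
  then have "norm (\<Phi> (scale_fun ?c \<phi>)) \<le> dual_norm e \<Phi>"
    by (intro dual_norm_ge \<Phi> Lip0_scale \<phi>)
  then have "inverse (lip_norm \<phi>) * norm (\<Phi> \<phi>) \<le> dual_norm e \<Phi>"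
    using pos by (simp add: dual_scale[OF \<Phi> \<phi>] norm_mult del: of_real_inverse)
  then show ?thesis using pos by (simp add: field_simps)
qed

lemma Lip0_dual_subspace:
  "fun_space.subspace (Lip0_dual e :: (('a::metric_space \<Rightarrow> 'b::real_normed_field) \<Rightarrow> 'b) set)"
proof (rule fun_space.subspaceI)
  show "0 \<in> Lip0_dual e"
    by (auto simp: Lip0_dual_def intro!: exI[of _ 0])
next
  fix \<Phi> \<Psi> :: "('a \<Rightarrow> 'b) \<Rightarrow> 'b" assume *: "\<Phi> \<in> Lip0_dual e" "\<Psi> \<in> Lip0_dual e"
  obtain C D where "\<And>\<phi>. \<phi> \<in> Lip0 e \<Longrightarrow> norm (\<Phi> \<phi>) \<le> C * lip_norm \<phi>"
    "\<And>\<phi>. \<phi> \<in> Lip0 e \<Longrightarrow> norm (\<Psi> \<phi>) \<le> D * lip_norm \<phi>"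
    using dual_bound[OF *(1)] dual_bound[OF *(2)] by metis
  then have "\<forall>\<phi>\<in>Lip0 e. norm ((\<Phi> + \<Psi>) \<phi>) \<le> (C + D) * lip_norm \<phi>"
    by (auto simp: distrib_right intro!: norm_triangle_le add_mono)
  then have "\<exists>C. \<forall>\<phi>\<in>Lip0 e. norm ((\<Phi> + \<Psi>) \<phi>) \<le> C * lip_norm \<phi>" ..
  then show "\<Phi> + \<Psi> \<in> Lip0_dual e"
    unfolding Lip0_dual_def
    by (auto simp: dual_add[OF *(1)] dual_add[OF *(2)] dual_scale[OF *(1)] dual_scale[OF *(2)]
        dual_outside[OF *(1)] dual_outside[OF *(2)] distrib_left)
next
  fix c and \<Phi> :: "('a \<Rightarrow> 'b) \<Rightarrow> 'b" assume *: "\<Phi> \<in> Lip0_dual e"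
  obtain C where "\<And>\<phi>. \<phi> \<in> Lip0 e \<Longrightarrow> norm (\<Phi> \<phi>) \<le> C * lip_norm \<phi>"
    using dual_bound[OF *(1)] by metis
  then have "\<forall>\<phi>\<in>Lip0 e. norm (scale_fun c \<Phi> \<phi>) \<le> (norm c * C) * lip_norm \<phi>"
    by (auto simp: norm_mult mult.assoc intro!: mult_left_mono)
  then have "\<exists>C. \<forall>\<phi>\<in>Lip0 e. norm (scale_fun c \<Phi> \<phi>) \<le> C * lip_norm \<phi>" ..
  then show "scale_fun c \<Phi> \<in> Lip0_dual e"
    unfolding Lip0_dual_def
    by (auto simp: dual_add[OF *] dual_scale[OF *] dual_outside[OF *] algebra_simps)
qed

lemmas dual_diff_in = fun_space.subspace_diff[OF Lip0_dual_subspace]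

lemma dual_norm_minus: "dual_norm e (\<Phi> - \<Psi>) = dual_norm e (\<Psi> - \<Phi>)"
  unfolding dual_norm_def by (simp add: norm_minus_commute)

lemma dual_norm_triangle:
  assumes "\<Phi> \<in> Lip0_dual e" "\<Psi> \<in> Lip0_dual e"
  shows "dual_norm e (\<Phi> + \<Psi>) \<le> dual_norm e \<Phi> + dual_norm e \<Psi>"
proof (rule dual_norm_le)
  show "norm ((\<Phi> + \<Psi>) \<phi>) \<le> (dual_norm e \<Phi> + dual_norm e \<Psi>) * lip_norm \<phi>" if "\<phi> \<in> Lip0 e" for \<phi>
    using dual_norm_bound[OF assms(1) that] dual_norm_bound[OF assms(2) that]
    by (auto simp: distrib_right intro!: norm_triangle_le add_mono)
qed (use assms dual_norm_nonneg in \<open>auto intro: add_nonneg_nonneg\<close>)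

lemma dual_norm_scale_le:
  assumes "\<Phi> \<in> Lip0_dual e"
  shows "dual_norm e (scale_fun c \<Phi>) \<le> norm c * dual_norm e \<Phi>"
proof (rule dual_norm_le)
  show "norm (c * \<Phi> \<phi>) \<le> norm c * dual_norm e \<Phi> * lip_norm \<phi>" if "\<phi> \<in> Lip0 e" for \<phi>
    using dual_norm_bound[OF assms(1) that]
    by (auto simp: norm_mult mult.assoc intro!: mult_left_mono)
qed (use dual_norm_nonneg[OF assms] in simp)

lemma dual_norm_eq_0:
  assumes "\<Phi> \<in> Lip0_dual e" "dual_norm e \<Phi> \<le> 0"
  shows "\<Phi> = 0"
proof
  fix \<phi> show "\<Phi> \<phi> = 0 \<phi>"
  proof (cases "\<phi> \<in> Lip0 e")
    case True
    have "dual_norm e \<Phi> = 0" using assms dual_norm_nonneg by force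
    with dual_norm_bound[OF assms(1) True] show ?thesis by simp
  qed (use assms dual_outside in auto)
qed

lemma dual_norm_zero: "dual_norm e 0 = 0"
  using dual_norm_nonneg[OF fun_space.subspace_0[OF Lip0_dual_subspace]]
  by (intro antisym dual_norm_le) auto


lemma dual_metric_space:
  "Metric_space (Lip0_dual e :: (('a::metric_space \<Rightarrow> 'b::real_normed_field) \<Rightarrow> 'b) set) (dual_dist e)"
proof
  fix \<Phi> \<Psi> \<Theta> :: "('a \<Rightarrow> 'b) \<Rightarrow> 'b"
  show "0 \<le> dual_dist e \<Phi> \<Psi>"
    by (simp add: dual_dist_def dual_norm_nonneg dual_diff_in)
  show "dual_dist e \<Phi> \<Psi> = dual_dist e \<Psi> \<Phi>"
    by (simp add: dual_dist_def dual_norm_minus[of e \<Phi>])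
  assume *: "\<Phi> \<in> Lip0_dual e" "\<Psi> \<in> Lip0_dual e"
  show "dual_dist e \<Phi> \<Psi> = 0 \<longleftrightarrow> \<Phi> = \<Psi>"
    using dual_norm_eq_0[OF dual_diff_in[OF *]] * by (auto simp: dual_dist_def dual_norm_zero)
  assume "\<Theta> \<in> Lip0_dual e"
  with * show "dual_dist e \<Phi> \<Theta> \<le> dual_dist e \<Phi> \<Psi> + dual_dist e \<Psi> \<Theta>"
    using dual_norm_triangle[OF dual_diff_in[of \<Phi> e \<Psi>] dual_diff_in[of \<Psi> e \<Theta>]]
    by (simp add: dual_dist_def)
qed

lemma eval_at_in_dual:
  "eval_at e x \<in> (Lip0_dual e :: (('a::metric_space \<Rightarrow> 'b::real_normed_field) \<Rightarrow> 'b) set)"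
  unfolding Lip0_dual_def
proof (safe)
  show "\<exists>C. \<forall>\<phi>\<in>(Lip0 e :: ('a \<Rightarrow> 'b) set). norm (eval_at e x \<phi>) \<le> C * lip_norm \<phi>"
  proof (intro exI[of _ "dist x e"] ballI)
    fix \<phi> :: "'a \<Rightarrow> 'b" assume "\<phi> \<in> Lip0 e"
    then show "norm (eval_at e x \<phi>) \<le> dist x e * lip_norm \<phi>"
      using lipschitz_onD[OF lip_norm_lipschitz, of \<phi> e x e]
      by (simp add: eval_at_def Lip0_def mult.commute)
  qed
qed (auto simp: eval_at_def Lip0_add Lip0_scale)

lemma span_eval_subset: "fun_space.span (range (eval_at e)) \<subseteq> Lip0_dual e"
  by (intro fun_space.span_minimal Lip0_dual_subspace) (auto simp: eval_at_in_dual)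

lemma lip_free_alt: "lip_free e = {\<Phi> \<in> Lip0_dual e.
    \<forall>r>0. \<exists>\<Psi> \<in> fun_space.span (range (eval_at e)). dual_norm e (\<Phi> - \<Psi>) < r}"
proof -
  interpret D: Metric_space "Lip0_dual e" "dual_dist e" by (rule dual_metric_space)
  show ?thesis
    using span_eval_subset[of e]
    unfolding lip_free_def dual_topology_def D.metric_closure_of D.in_mball dual_dist_def
    by (simp add: subset_iff Bex_def cong: conj_cong) blast
qed

lemma lip_free_approx:
  assumes "\<Phi> \<in> lip_free e" "r > 0"
  obtains \<Psi> where "\<Psi> \<in> fun_space.span (range (eval_at e))" "dual_norm e (\<Phi> - \<Psi>) < r"
  using assms unfolding lip_free_alt by blast

lemma lip_free_subset: "lip_free e \<subseteq> Lip0_dual e"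
  by (auto simp: lip_free_alt)

lemma span_subset_lip_free:
  "fun_space.span (range (eval_at e)) \<subseteq> (lip_free e :: (('a::metric_space \<Rightarrow> 'b::real_normed_field) \<Rightarrow> 'b) set)"
proof
  fix \<Phi> :: "('a \<Rightarrow> 'b) \<Rightarrow> 'b" assume "\<Phi> \<in> fun_space.span (range (eval_at e))"
  then show "\<Phi> \<in> lip_free e"
    using span_eval_subset[of e] by (force simp: lip_free_alt dual_norm_zero intro: bexI[of _ \<Phi>])
qed

lemma eval_at_in_lip_free: "eval_at e x \<in> lip_free e"
  using span_subset_lip_free[of e] fun_space.span_base[of "eval_at e x" "range (eval_at e)"] by blast

lemma lip_free_subspace:
  "fun_space.subspace (lip_free e :: (('a::metric_space \<Rightarrow> 'b::real_normed_field) \<Rightarrow> 'b) set)"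
proof (rule fun_space.subspaceI)
  show "0 \<in> lip_free e"
    using span_subset_lip_free fun_space.span_zero by blast
next
  fix \<Phi> \<Psi> :: "('a \<Rightarrow> 'b) \<Rightarrow> 'b" assume *: "\<Phi> \<in> lip_free e" "\<Psi> \<in> lip_free e"
  let ?S = "fun_space.span (range (eval_at e)) :: (('a \<Rightarrow> 'b) \<Rightarrow> 'b) set"
  have D: "\<Phi> \<in> Lip0_dual e" "\<Psi> \<in> Lip0_dual e" using * lip_free_subset by blast+
  have "\<exists>\<Theta>\<in>?S. dual_norm e (\<Phi> + \<Psi> - \<Theta>) < r" if "r > 0" for r
  proof -
    have "r/2 > 0" using that by simp
    with * obtain \<Phi>' \<Psi>' where S: "\<Phi>' \<in> ?S" "\<Psi>' \<in> ?S"
      and r: "dual_norm e (\<Phi> - \<Phi>') < r/2" "dual_norm e (\<Psi> - \<Psi>') < r/2"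
      by (metis lip_free_approx)
    have "\<Phi> - \<Phi>' \<in> Lip0_dual e" "\<Psi> - \<Psi>' \<in> Lip0_dual e"
      using D S span_eval_subset by (blast intro: dual_diff_in)+
    from dual_norm_triangle[OF this] r have "dual_norm e (\<Phi> + \<Psi> - (\<Phi>' + \<Psi>')) < r"
      by (simp add: add_diff_add)
    then show ?thesis using S fun_space.span_add by blast
  qed
  then show "\<Phi> + \<Psi> \<in> lip_free e"
    using D fun_space.subspace_add[OF Lip0_dual_subspace] by (auto simp: lip_free_alt)
next
  fix c and \<Phi> :: "('a \<Rightarrow> 'b) \<Rightarrow> 'b" assume *: "\<Phi> \<in> lip_free e"
  let ?S = "fun_space.span (range (eval_at e)) :: (('a \<Rightarrow> 'b) \<Rightarrow> 'b) set"
  have D: "\<Phi> \<in> Lip0_dual e" using * lip_free_subset by blast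
  have "\<exists>\<Theta>\<in>?S. dual_norm e (scale_fun c \<Phi> - \<Theta>) < r" if "r > 0" for r
  proof -
    have pos: "norm c + 1 > 0" by (simp add: add_nonneg_pos)
    with * that obtain \<Phi>' where S: "\<Phi>' \<in> ?S" and r: "dual_norm e (\<Phi> - \<Phi>') < r / (norm c + 1)"
      by (metis lip_free_approx divide_pos_pos)
    have D': "\<Phi> - \<Phi>' \<in> Lip0_dual e"
      using D S span_eval_subset by (blast intro: dual_diff_in)
    have "dual_norm e (scale_fun c (\<Phi> - \<Phi>')) \<le> norm c * dual_norm e (\<Phi> - \<Phi>')"
      by (rule dual_norm_scale_le[OF D'])
    also have "\<dots> \<le> (norm c + 1) * dual_norm e (\<Phi> - \<Phi>')"
      using dual_norm_nonneg[OF D'] by (simp add: mult_right_mono)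
    also have "\<dots> < r" using r pos by (simp add: field_simps)
    finally have "dual_norm e (scale_fun c \<Phi> - scale_fun c \<Phi>') < r"
      by (simp only: fun_space.scale_right_diff_distrib)
    then show ?thesis using S fun_space.span_scale by blast
  qed
  then show "scale_fun c \<Phi> \<in> lip_free e"
    using D fun_space.subspace_scale[OF Lip0_dual_subspace] by (auto simp: lip_free_alt)
qed

definition pullback :: "('a \<Rightarrow> 'a) \<Rightarrow> 'a \<Rightarrow> ('a \<Rightarrow> 'k) \<Rightarrow> 'a \<Rightarrow> 'k::real_normed_field"
  where "pullback f e \<phi> = (\<lambda>x. \<phi> (f x) - \<phi> (f e))"

definition adjoint_pullback :: "('a::metric_space \<Rightarrow> 'a) \<Rightarrow> 'a \<Rightarrow>
    (('a \<Rightarrow> 'k::real_normed_field) \<Rightarrow> 'k) \<Rightarrow> (('a \<Rightarrow> 'k) \<Rightarrow> 'k)"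
  where "adjoint_pullback f e \<Phi> = (\<lambda>\<phi>. if \<phi> \<in> Lip0 e then \<Phi> (pullback f e \<phi>) else 0)"

lemma lipschitz_on_pullback:
  assumes "L-lipschitz_on UNIV f" "K-lipschitz_on UNIV \<phi>"
  shows "(L * K)-lipschitz_on UNIV (pullback f e \<phi>)"
proof (rule lipschitz_onI)
  fix x y
  have "dist (pullback f e \<phi> x) (pullback f e \<phi> y) = dist (\<phi> (f x)) (\<phi> (f y))"
    by (simp add: pullback_def dist_norm)
  also have "\<dots> \<le> K * dist (f x) (f y)" using lipschitz_onD[OF assms(2)] by simp
  also have "\<dots> \<le> K * (L * dist x y)"
    using lipschitz_onD[OF assms(1)] lipschitz_on_nonneg[OF assms(2)] by (simp add: mult_left_mono)
  finally show "dist (pullback f e \<phi> x) (pullback f e \<phi> y) \<le> L * K * dist x y"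
    by (simp add: mult_ac)
qed (use assms[THEN lipschitz_on_nonneg] in simp)

lemma pullback_in_Lip0:
  assumes "L-lipschitz_on UNIV f" "\<phi> \<in> Lip0 e"
  shows "pullback f e \<phi> \<in> Lip0 e" "lip_norm (pullback f e \<phi>) \<le> L * lip_norm \<phi>"
  using lipschitz_on_pullback[OF assms(1) lip_norm_lipschitz[OF assms(2)], of e]
  by (auto simp: Lip0_def pullback_def intro: lip_norm_le)

context
  fixes f :: "'a::metric_space \<Rightarrow> 'a" and e :: 'a and L :: real
  assumes L: "L-lipschitz_on UNIV f"
begin

lemma adjoint_pullback_bound:
  assumes \<Phi>: "\<Phi> \<in> Lip0_dual e" and \<phi>: "\<phi> \<in> Lip0 e"
  shows "norm (adjoint_pullback f e \<Phi> \<phi>) \<le> (L * dual_norm e \<Phi>) * lip_norm \<phi>"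
proof -
  have "norm (adjoint_pullback f e \<Phi> \<phi>) \<le> dual_norm e \<Phi> * lip_norm (pullback f e \<phi>)"
    using dual_norm_bound[OF \<Phi> pullback_in_Lip0(1)[OF L \<phi>]] \<phi> by (simp add: adjoint_pullback_def)
  also have "\<dots> \<le> dual_norm e \<Phi> * (L * lip_norm \<phi>)"
    using pullback_in_Lip0(2)[OF L \<phi>] dual_norm_nonneg[OF \<Phi>] by (rule mult_left_mono)
  finally show ?thesis by (simp add: mult_ac)
qed

lemma adjoint_pullback_norm:
  "\<Phi> \<in> Lip0_dual e \<Longrightarrow> dual_norm e (adjoint_pullback f e \<Phi>) \<le> L * dual_norm e \<Phi>"
  by (intro dual_norm_le adjoint_pullback_bound mult_nonneg_nonneg dual_norm_nonneg
      lipschitz_on_nonneg[OF L])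

lemma adjoint_pullback_in_dual:
  fixes \<Phi> :: "('a \<Rightarrow> 'b::real_normed_field) \<Rightarrow> 'b"
  assumes \<Phi>: "\<Phi> \<in> Lip0_dual e"
  shows "adjoint_pullback f e \<Phi> \<in> Lip0_dual e"
proof -
  have 1: "pullback f e (\<phi> + \<psi>) = pullback f e \<phi> + pullback f e \<psi>" for \<phi> \<psi> :: "'a \<Rightarrow> 'b"
    by (auto simp: pullback_def fun_eq_iff)
  have 2: "pullback f e (scale_fun c \<phi>) = scale_fun c (pullback f e \<phi>)" for c and \<phi> :: "'a \<Rightarrow> 'b"
    by (auto simp: pullback_def fun_eq_iff algebra_simps)
  show ?thesis
    unfolding Lip0_dual_def
  proof safe
    show "\<exists>C. \<forall>\<phi>\<in>Lip0 e. norm (adjoint_pullback f e \<Phi> \<phi>) \<le> C * lip_norm \<phi>"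
      using adjoint_pullback_bound[OF \<Phi>] by blast
  qed (auto simp: adjoint_pullback_def 1 2 Lip0_add Lip0_scale pullback_in_Lip0(1)[OF L]
      dual_add[OF \<Phi>] dual_scale[OF \<Phi>])
qed

lemma adjoint_pullback_linear:
  "adjoint_pullback f e (\<Phi> + \<Psi>) = adjoint_pullback f e \<Phi> + adjoint_pullback f e \<Psi>"
  "adjoint_pullback f e (\<Phi> - \<Psi>) = adjoint_pullback f e \<Phi> - adjoint_pullback f e \<Psi>"
  "adjoint_pullback f e (scale_fun c \<Phi>) = scale_fun c (adjoint_pullback f e \<Phi>)"
  by (auto simp: adjoint_pullback_def fun_eq_iff)

lemma adjoint_pullback_eval_at:
  "adjoint_pullback f e (eval_at e x) = eval_at e (f x) - eval_at e (f e)"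
  by (auto simp: adjoint_pullback_def eval_at_def fun_eq_iff pullback_in_Lip0(1)[OF L])
    (auto simp: pullback_def)

lemma adjoint_pullback_span:
  fixes \<Phi> :: "('a \<Rightarrow> 'b::real_normed_field) \<Rightarrow> 'b"
  assumes "\<Phi> \<in> fun_space.span (range (eval_at e))"
  shows "adjoint_pullback f e \<Phi> \<in> fun_space.span (range (eval_at e))"
  using assms
proof (induction rule: fun_space.span_induct_alt)
  case base
  have "adjoint_pullback f e (0 :: ('a \<Rightarrow> 'b) \<Rightarrow> 'b) = 0"
    by (auto simp: adjoint_pullback_def fun_eq_iff)
  then show ?case using fun_space.span_zero by metis
next
  case (step c \<Phi> \<Psi>)
  then obtain x where x: "\<Phi> = eval_at e x" by blast
  show ?case
    unfolding adjoint_pullback_linear x adjoint_pullback_eval_at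
    by (intro fun_space.span_add fun_space.span_scale fun_space.span_diff step)
      (auto intro: fun_space.span_base)
qed

lemma adjoint_pullback_lip_free:
  fixes \<Phi> :: "('a \<Rightarrow> 'b::real_normed_field) \<Rightarrow> 'b"
  assumes "\<Phi> \<in> lip_free e"
  shows "adjoint_pullback f e \<Phi> \<in> lip_free e"
proof -
  let ?S = "fun_space.span (range (eval_at e)) :: (('a \<Rightarrow> 'b) \<Rightarrow> 'b) set"
  have D: "\<Phi> \<in> Lip0_dual e" using assms lip_free_subset by blast
  have "\<exists>\<Psi>\<in>?S. dual_norm e (adjoint_pullback f e \<Phi> - \<Psi>) < r" if "r > 0" for r
  proof -
    have pos: "L + 1 > 0" using lipschitz_on_nonneg[OF L] by simp
    with assms that obtain \<Phi>' where S: "\<Phi>' \<in> ?S" and r: "dual_norm e (\<Phi> - \<Phi>') < r / (L + 1)"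
      by (metis lip_free_approx divide_pos_pos)
    have D': "\<Phi> - \<Phi>' \<in> Lip0_dual e"
      using D S span_eval_subset by (blast intro: dual_diff_in)
    have "dual_norm e (adjoint_pullback f e (\<Phi> - \<Phi>')) \<le> L * dual_norm e (\<Phi> - \<Phi>')"
      by (rule adjoint_pullback_norm[OF D'])
    also have "\<dots> \<le> (L + 1) * dual_norm e (\<Phi> - \<Phi>')"
      using dual_norm_nonneg[OF D'] by (simp add: mult_right_mono)
    also have "\<dots> < r" using r pos by (simp add: field_simps)
    finally show ?thesis
      unfolding adjoint_pullback_linear using adjoint_pullback_span[OF S] by blast
  qed
  then show ?thesis using adjoint_pullback_in_dual[OF D] by (auto simp: lip_free_alt)
qed

end

lemma bounded_operator_unique:
  fixes T :: "(('a::metric_space \<Rightarrow> 'b::real_normed_field) \<Rightarrow> 'b) \<Rightarrow> (('a \<Rightarrow> 'b) \<Rightarrow> 'b)"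
  assumes T: "bounded_operator e T" and U: "bounded_operator e U"
    and eq: "\<And>x. T (eval_at e x) = U (eval_at e x)" and \<Phi>: "\<Phi> \<in> lip_free e"
  shows "T \<Phi> = U \<Phi>"
proof -
  let ?S = "fun_space.span (range (eval_at e)) :: (('a \<Rightarrow> 'b) \<Rightarrow> 'b) set"
  have Fdiff: "\<And>\<Phi> \<Psi>. \<Phi> \<in> lip_free e \<Longrightarrow> \<Psi> \<in> lip_free e \<Longrightarrow> \<Phi> - \<Psi> \<in> lip_free e"
    by (rule fun_space.subspace_diff[OF lip_free_subspace])
  have in_F: "T \<Psi> \<in> lip_free e" "U \<Psi> \<in> lip_free e" if "\<Psi> \<in> lip_free e" for \<Psi>
    using T U that by (auto simp: bounded_operator_def)
  have add: "T (\<Psi> + \<Theta>) = T \<Psi> + T \<Theta>" "U (\<Psi> + \<Theta>) = U \<Psi> + U \<Theta>"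
    if "\<Psi> \<in> lip_free e" "\<Theta> \<in> lip_free e" for \<Psi> \<Theta>
    using T U that by (auto simp: bounded_operator_def)
  have scale: "T (scale_fun c \<Psi>) = scale_fun c (T \<Psi>)" "U (scale_fun c \<Psi>) = scale_fun c (U \<Psi>)"
    if "\<Psi> \<in> lip_free e" for \<Psi> c
    using T U that by (auto simp: bounded_operator_def)
  have diff: "T (\<Psi> - \<Theta>) = T \<Psi> - T \<Theta>" "U (\<Psi> - \<Theta>) = U \<Psi> - U \<Theta>"
    if "\<Psi> \<in> lip_free e" "\<Theta> \<in> lip_free e" for \<Psi> \<Theta>
    using add[of "\<Psi> - \<Theta>" \<Theta>] Fdiff[OF that] that by (simp_all add: algebra_simps)
  have span: "\<Psi> \<in> lip_free e \<and> T \<Psi> = U \<Psi>" if "\<Psi> \<in> ?S" for \<Psi>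
    using that
  proof (induction rule: fun_space.span_induct_alt)
    case base
    have "0 \<in> lip_free e" by (rule fun_space.subspace_0[OF lip_free_subspace])
    with scale[OF this, of 0] show ?case by (simp add: zero_fun_def)
  next
    case (step c \<Psi> \<Theta>)
    then obtain x where x: "\<Psi> = eval_at e x" by blast
    have F: "eval_at e x \<in> lip_free e" "scale_fun c (eval_at e x) \<in> lip_free e" "\<Theta> \<in> lip_free e"
      using step(2) eval_at_in_lip_free
        fun_space.subspace_scale[OF lip_free_subspace] by blast+
    show ?case
      using fun_space.subspace_add[OF lip_free_subspace F(2,3)] step(2)
      unfolding x add[OF F(2,3)] scale[OF F(1)] by (simp add: eq plus_fun_def)
  qed
  obtain C where C: "\<forall>\<Psi>\<in>lip_free e. dual_norm e (T \<Psi>) \<le> C * dual_norm e \<Psi>"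
    using T unfolding bounded_operator_def by (elim conjE exE)
  obtain D where D: "\<forall>\<Psi>\<in>lip_free e. dual_norm e (U \<Psi>) \<le> D * dual_norm e \<Psi>"
    using U unfolding bounded_operator_def by (elim conjE exE)
  define K where "K = \<bar>C\<bar> + \<bar>D\<bar> + 1"
  have K: "K > 0" unfolding K_def by linarith
  have in_D: "T \<Phi> - U \<Phi> \<in> Lip0_dual e"
    using in_F[OF \<Phi>] lip_free_subset by (blast intro: dual_diff_in)
  have small: "dual_norm e (T \<Phi> - U \<Phi>) < r" if "r > 0" for r
  proof -
    from \<Phi> K that obtain \<Psi> where S: "\<Psi> \<in> ?S" and r: "dual_norm e (\<Phi> - \<Psi>) < r / K"
      by (metis lip_free_approx divide_pos_pos)
    have \<Psi>: "\<Psi> \<in> lip_free e" using S span_subset_lip_free by blast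
    let ?d = "dual_norm e (\<Phi> - \<Psi>)"
    have F: "\<Phi> - \<Psi> \<in> lip_free e" by (rule Fdiff[OF \<Phi> \<Psi>])
    have d: "?d \<ge> 0" using F lip_free_subset dual_norm_nonneg by blast
    have TU: "T (\<Phi> - \<Psi>) \<in> Lip0_dual e" "U (\<Phi> - \<Psi>) \<in> Lip0_dual e"
      using in_F[OF F] lip_free_subset by blast+
    have "T \<Phi> - U \<Phi> = T (\<Phi> - \<Psi>) + (0 - U (\<Phi> - \<Psi>))"
      using span[OF S] by (simp add: diff[OF \<Phi> \<Psi>])
    then have "dual_norm e (T \<Phi> - U \<Phi>) \<le> dual_norm e (T (\<Phi> - \<Psi>)) + dual_norm e (0 - U (\<Phi> - \<Psi>))"
      using dual_norm_triangle[OF TU(1) dual_diff_in[OF fun_space.subspace_0[OF Lip0_dual_subspace] TU(2)]]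
      by (simp only:)
    also have "dual_norm e (0 - U (\<Phi> - \<Psi>)) = dual_norm e (U (\<Phi> - \<Psi>))"
      by (subst dual_norm_minus) simp
    also have "dual_norm e (T (\<Phi> - \<Psi>)) + dual_norm e (U (\<Phi> - \<Psi>)) \<le> C * ?d + D * ?d"
      using bspec[OF C F] bspec[OF D F] by linarith
    also have "\<dots> \<le> K * ?d"
      unfolding K_def distrib_right[symmetric] by (rule mult_right_mono[OF _ d]) linarith
    also have "\<dots> < r" using r K by (simp add: field_simps)
    finally show ?thesis .
  qed
  have "dual_norm e (T \<Phi> - U \<Phi>) \<le> 0"
    using small[of "dual_norm e (T \<Phi> - U \<Phi>)"] by force
  from dual_norm_eq_0[OF in_D this] show ?thesis by simp
qed

theorem lip_free_op_ex1:
  fixes f :: "'a::metric_space \<Rightarrow> 'a"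
  assumes L: "L-lipschitz_on UNIV f"
  shows "\<exists>!T :: (('a \<Rightarrow> 'k::real_normed_field) \<Rightarrow> 'k) \<Rightarrow> (('a \<Rightarrow> 'k) \<Rightarrow> 'k).
    T \<in> extensional (lip_free e) \<and> bounded_operator e T \<and>
    (\<forall>x. T (eval_at e x) = eval_at e (f x) - eval_at e (f e))"
proof (rule ex_ex1I)
  let ?T = "restrict (adjoint_pullback f e) (lip_free e) ::
    (('a \<Rightarrow> 'k) \<Rightarrow> 'k) \<Rightarrow> (('a \<Rightarrow> 'k) \<Rightarrow> 'k)"
  have "bounded_operator e ?T"
    unfolding bounded_operator_def
  proof (intro conjI ballI allI)
    show "?T \<in> lip_free e \<rightarrow> lip_free e"
      using adjoint_pullback_lip_free[OF L] by auto
    show "?T (\<Phi> + \<Psi>) = ?T \<Phi> + ?T \<Psi>" if "\<Phi> \<in> lip_free e" "\<Psi> \<in> lip_free e" for \<Phi> \<Psi>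
      using that fun_space.subspace_add[OF lip_free_subspace that]
      by (simp add: adjoint_pullback_linear[OF L])
    show "?T (scale_fun c \<Phi>) = scale_fun c (?T \<Phi>)" if "\<Phi> \<in> lip_free e" for c \<Phi>
      using that fun_space.subspace_scale[OF lip_free_subspace that, of c]
      by (simp add: adjoint_pullback_linear[OF L])
    have "dual_norm e (?T \<Phi>) \<le> L * dual_norm e \<Phi>" if "\<Phi> \<in> lip_free e" for \<Phi>
      using that lip_free_subset adjoint_pullback_norm[OF L] by auto
    then show "\<exists>C. \<forall>\<Phi>\<in>lip_free e. dual_norm e (?T \<Phi>) \<le> C * dual_norm e \<Phi>" by blast
  qed
  then show "\<exists>T :: (('a \<Rightarrow> 'k) \<Rightarrow> 'k) \<Rightarrow> (('a \<Rightarrow> 'k) \<Rightarrow> 'k).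
    T \<in> extensional (lip_free e) \<and> bounded_operator e T \<and>
    (\<forall>x. T (eval_at e x) = eval_at e (f x) - eval_at e (f e))"
    by (intro exI[of _ ?T]) (simp add: eval_at_in_lip_free adjoint_pullback_eval_at[OF L])
next
  fix T U :: "(('a \<Rightarrow> 'k) \<Rightarrow> 'k) \<Rightarrow> (('a \<Rightarrow> 'k) \<Rightarrow> 'k)"
  assume T: "T \<in> extensional (lip_free e) \<and> bounded_operator e T \<and>
    (\<forall>x. T (eval_at e x) = eval_at e (f x) - eval_at e (f e))"
  assume U: "U \<in> extensional (lip_free e) \<and> bounded_operator e U \<and>
    (\<forall>x. U (eval_at e x) = eval_at e (f x) - eval_at e (f e))"
  show "T = U"
    by (rule extensionalityI[of _ "lip_free e"])
      (use T U bounded_operator_unique[of e T U] in auto)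
qed

end

theory Submission
  imports Defs
begin

text \<open>
  If \<open>f\<close> maps \<open>N\<close> into itself, the elements of the free space that annihilate every Lipschitz
  function constant on \<open>N\<close> form a closed invariant subspace. It is non-trivial when \<open>N\<close> has two
  points and is not dense. Such an \<open>N\<close> is obtained from forward orbits: a finite set is not dense
  because the space is infinite, and a set missing an isolated point \<open>p\<close> is not dense. An orbit
  that is infinite and passes through \<open>p\<close> never returns to \<open>p\<close>, so the orbit of \<open>f p\<close> misses \<open>p\<close>.
\<close>

section \<open>Invariant sets that are not dense\<close>

lemma orbit_invariant: "f ` range (\<lambda>n. (f ^^ n) x) \<subseteq> range (\<lambda>n. (f ^^ n) x)"
proof clarify
  fix n
  show "f ((f ^^ n) x) \<in> range (\<lambda>n. (f ^^ n) x)"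
    by (rule range_eqI[of _ _ "Suc n"]) simp
qed

text \<open>From index \<open>i\<close> on the orbit has the positive period \<open>Suc j\<close>,
  so later iterates only repeat earlier ones.\<close>

lemma finite_orbit:
  fixes f :: "'a \<Rightarrow> 'a"
  assumes "(f ^^ (i + Suc j)) x = (f ^^ i) x"
  shows "finite (range (\<lambda>n. (f ^^ n) x))"
proof -
  have "(f ^^ n) x \<in> (\<lambda>n. (f ^^ n) x) ` {..i + Suc j}" for n
  proof (cases "n \<le> i")
    case False
    then obtain m where n: "n = m + i" by (metis le_add_diff_inverse2 linear)
    have "(f ^^ Suc j) ((f ^^ i) x) = (f ^^ i) x"
      using assms by (metis add.commute comp_apply funpow_add)
    then have "(f ^^ (m mod Suc j)) ((f ^^ i) x) = (f ^^ m) ((f ^^ i) x)"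
      by (rule funpow_mod_eq)
    then have "(f ^^ n) x = (f ^^ (m mod Suc j + i)) x"
      by (simp add: n funpow_add)
    moreover have "m mod Suc j + i \<le> i + Suc j"
      using mod_less_divisor[of "Suc j" m] by linarith
    ultimately show ?thesis by (metis atMost_iff imageI)
  qed auto
  then show ?thesis
    by (meson finite_atMost finite_imageI finite_subset image_subsetI)
qed

text \<open>The radius of a ball around \<open>p\<close> that contains no other point bounds all
  distances from \<open>p\<close> to \<open>N\<close> from below.\<close>

lemma infdist_isolated_pos:
  fixes p :: "'a::metric_space"
  assumes "p isolated_in UNIV" "p \<notin> N" "N \<noteq> {}"
  shows "infdist p N > 0"
proof -
  obtain d where d: "d > 0" "\<And>y. dist p y < d \<Longrightarrow> y = p"
    using assms(1) by (auto simp: isolated_in_dist_Ex_iff)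
  then have "d \<le> infdist p N"
    unfolding infdist_notempty[OF assms(3)] using assms(2)
    by (intro cINF_greatest assms(3)) (metis linorder_not_less)
  with d(1) show ?thesis by simp
qed

lemma infdist_finite_pos:
  fixes N :: "'a::metric_space set"
  assumes "infinite (UNIV :: 'a set)" "finite N" "N \<noteq> {}"
  shows "\<exists>r. infdist r N > 0"
proof -
  obtain r where "r \<notin> N" using assms(1,2) by (metis ex_new_if_finite)
  then have "infdist r N > 0"
    using assms by (intro infdist_pos_not_in_closed finite_imp_closed) auto
  then show ?thesis ..
qed

lemma ex_invariant_nondense:
  fixes f :: "'a::metric_space \<Rightarrow> 'a" and p :: 'a
  assumes inf: "infinite (UNIV :: 'a set)" and p: "p isolated_in UNIV"
  shows "\<exists>N x y r. f ` N \<subseteq> N \<and> x \<in> N \<and> y \<in> N \<and> x \<noteq> y \<and> infdist r N > 0"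
proof -
  have main: ?thesis if "f ` N \<subseteq> N" "x \<in> N" "y \<in> N" "x \<noteq> y" "finite N \<or> p \<notin> N" for N x y
    using that infdist_finite_pos[OF inf, of N] infdist_isolated_pos[OF p, of N] by blast
  let ?O = "\<lambda>x. range (\<lambda>n. (f ^^ n) x)"
  have self: "x \<in> ?O x" for x by (rule range_eqI[of _ _ 0]) simp
  have step: "f x \<in> ?O x" for x by (rule range_eqI[of _ _ 1]) simp
  \<comment> \<open>A point \<open>q\<close> that \<open>f\<close> moves supplies the two points
    \<open>q\<close> and \<open>f q\<close> of its orbit; only non-density remains.\<close>
  have orbit: ?thesis if "f q \<noteq> q" "finite (?O q) \<or> p \<notin> ?O q" for q
    using main[OF orbit_invariant step self] that by blast
  show ?thesis
  proof (cases "p \<in> ?O (f p)")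
    case True
    then obtain n where "p = (f ^^ n) (f p)" by blast
    then have n: "(f ^^ Suc n) p = p"
      unfolding funpow_Suc_right comp_apply by (rule sym)
    \<comment> \<open>Here \<open>p\<close> is periodic, so any orbit that reaches \<open>p\<close>
      repeats from there on.\<close>
    have orbits: "finite (?O q) \<or> p \<notin> ?O q" for q
    proof -
      have "(f ^^ (i + Suc n)) q = (f ^^ i) q" if "(f ^^ i) q = p" for i
        using n that by (metis add.commute comp_apply funpow_add)
      then show ?thesis using finite_orbit[of _ n f q] by blast
    qed
    show ?thesis
    proof (cases "\<exists>q. f q \<noteq> q")
      case True
      with orbit orbits show ?thesis by blast
    next
      case False
      \<comment> \<open>Now \<open>f\<close> is the identity and every two-point set is
        invariant.\<close>
      obtain q where "q \<noteq> p" using inf by (metis ex_new_if_finite finite.simps insertI1)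
      with False main[of "{p, q}" p q] show ?thesis by simp
    qed
  next
    case False
    show ?thesis
    proof (cases "f (f p) = f p")
      case True
      \<comment> \<open>As \<open>f p\<close> is fixed, \<open>{p, f p}\<close> is a finite
        invariant set; its points differ because \<open>p\<close> is off the orbit of
        \<open>f p\<close>.\<close>
      have "f p \<noteq> p" using False self[of "f p"] by auto
      with True main[of "{p, f p}" p "f p"] show ?thesis by simp
    next
      case nonfixed: False
      \<comment> \<open>The orbit of \<open>f p\<close> misses \<open>p\<close> and contains the
        distinct points \<open>f p\<close> and \<open>f (f p)\<close>.\<close>
      with False orbit show ?thesis by blast
    qed
  qed
qed

section \<open>The operator as an adjoint\<close>

lemma bounded_operator_adjoint_pullback:
  assumes L: "L-lipschitz_on UNIV f"
  shows "bounded_operator e (adjoint_pullback f e ::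
    (('a::metric_space \<Rightarrow> 'k::real_normed_field) \<Rightarrow> 'k) \<Rightarrow> (('a \<Rightarrow> 'k) \<Rightarrow> 'k))"
  unfolding bounded_operator_def
proof (intro conjI ballI allI)
  show "\<exists>C. \<forall>\<Phi>\<in>lip_free e. dual_norm e (adjoint_pullback f e \<Phi> :: ('a \<Rightarrow> 'k) \<Rightarrow> 'k)
      \<le> C * dual_norm e \<Phi>"
    using adjoint_pullback_norm[OF L] lip_free_subset by blast
qed (use adjoint_pullback_lip_free[OF L] adjoint_pullback_linear[OF L] in auto)

text \<open>Both operators are bounded and agree on the evaluations, whose span is dense. This
  replaces the definite description by a formula.\<close>

lemma lip_free_op_eq_adjoint_pullback:
  fixes \<Phi> :: "('a::metric_space \<Rightarrow> 'k::real_normed_field) \<Rightarrow> 'k"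
  assumes L: "L-lipschitz_on UNIV f" and \<Phi>: "\<Phi> \<in> lip_free e"
  shows "lip_free_op f e \<Phi> = adjoint_pullback f e \<Phi>"
proof (rule bounded_operator_unique[OF _ bounded_operator_adjoint_pullback[OF L] _ \<Phi>])
  let ?T = "lip_free_op f e :: (('a \<Rightarrow> 'k) \<Rightarrow> 'k) \<Rightarrow> (('a \<Rightarrow> 'k) \<Rightarrow> 'k)"
  have *: "bounded_operator e ?T \<and> (\<forall>x. ?T (eval_at e x) = eval_at e (f x) - eval_at e (f e))"
    using theI'[OF lip_free_op_ex1[OF L]] unfolding lip_free_op_def by (rule conjunct2)
  then show "bounded_operator e ?T" by (rule conjunct1)
  show "?T (eval_at e x) = adjoint_pullback f e (eval_at e x)" for x
    unfolding adjoint_pullback_eval_at[OF L] using * by (elim conjE) (rule spec)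
qed

section \<open>The annihilator and its non-triviality\<close>

lemma closedin_dual_annihilator:
  fixes A :: "('a::metric_space \<Rightarrow> 'k::real_normed_field) set"
  assumes A: "A \<subseteq> Lip0 e"
  shows "closedin (dual_topology e) {\<Phi> \<in> Lip0_dual e. \<forall>\<phi>\<in>A. \<Phi> \<phi> = 0}"
proof -
  interpret D: Metric_space "Lip0_dual e :: (('a \<Rightarrow> 'k) \<Rightarrow> 'k) set" "dual_dist e"
    by (rule dual_metric_space)
  let ?C = "{\<Phi> \<in> Lip0_dual e. \<forall>\<phi>\<in>A. \<Phi> \<phi> = 0}"
  have "\<exists>r>0. disjnt ?C (D.mball \<Phi> r)" if \<Phi>: "\<Phi> \<in> Lip0_dual e - ?C" for \<Phi>
  proof -
    from \<Phi> obtain \<phi> where \<phi>: "\<phi> \<in> A" "\<Phi> \<phi> \<noteq> 0" by blast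
    with A have \<phi>0: "\<phi> \<in> Lip0 e" by blast
    \<comment> \<open>The complement is open: \<open>\<Psi> \<phi> = 0\<close> forces
      \<open>norm (\<Phi> \<phi>)\<close> to be at most
      \<open>dual_norm e (\<Phi> - \<Psi>) * lip_norm \<phi>\<close>, which fails within distance
      \<open>?r\<close> of \<open>\<Phi>\<close>. The summand 1 keeps the denominator
      positive.\<close>
    let ?K = "lip_norm \<phi> + 1"
    let ?r = "norm (\<Phi> \<phi>) / ?K"
    have K: "?K > 0" using lip_norm_nonneg[OF \<phi>0] by simp
    have False if \<Psi>: "\<Psi> \<in> ?C" "\<Psi> \<in> D.mball \<Phi> ?r" for \<Psi>
    proof -
      have D: "\<Phi> - \<Psi> \<in> Lip0_dual e" using \<Phi> \<Psi>(1) by (blast intro: dual_diff_in)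
      have "dual_norm e (\<Phi> - \<Psi>) < ?r"
        using \<Psi> \<Phi> unfolding D.in_mball dual_dist_def by (auto split: if_splits)
      then have "dual_norm e (\<Phi> - \<Psi>) * ?K < norm (\<Phi> \<phi>)"
        using K by (simp add: field_simps)
      moreover have "norm (\<Phi> \<phi>) \<le> dual_norm e (\<Phi> - \<Psi>) * lip_norm \<phi>"
        using dual_norm_bound[OF D \<phi>0] \<Psi>(1) \<phi>(1) by simp
      ultimately show False
        using dual_norm_nonneg[OF D] by (simp add: distrib_left)
    qed
    moreover have "?r > 0" using \<phi>(2) K by simp
    ultimately show ?thesis unfolding disjnt_def by blast
  qed
  then show ?thesis
    unfolding dual_topology_def D.closedin_metric by blast
qed

text \<open>Subtracting the value at \<open>e\<close> preserves all increments. This turns distance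
  functions into test functions over any scalar field \<open>'k\<close>.\<close>

lemma of_real_nonexpansive_in_Lip0:
  fixes g :: "'a::metric_space \<Rightarrow> real"
  assumes "\<And>x y. \<bar>g x - g y\<bar> \<le> dist x y"
  shows "(\<lambda>x. of_real (g x) - of_real (g e) :: 'k::real_normed_field) \<in> Lip0 e"
proof -
  have "1-lipschitz_on UNIV (\<lambda>x. of_real (g x) - of_real (g e) :: 'k)"
    using assms by (intro lipschitz_onI) (simp_all add: dist_norm flip: of_real_diff)
  then show ?thesis by (auto simp: Lip0_def)
qed

lemma nontrivial_invariant_subspaceI:
  fixes f :: "'a::metric_space \<Rightarrow> 'a" and e :: 'a
  assumes L: "L-lipschitz_on UNIV f"
    and N: "f ` N \<subseteq> N" "x \<in> N" "y \<in> N" "x \<noteq> y" and r: "infdist r N > 0"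
  shows "\<exists>S :: (('a \<Rightarrow> 'k::real_normed_field) \<Rightarrow> 'k) set.
    nontrivial_invariant_subspace e (lip_free_op f e) S"
proof -
  \<comment> \<open>The common value on \<open>N\<close> is left free, since \<open>e\<close> need
    not lie in \<open>N\<close>.\<close>
  define A :: "('a \<Rightarrow> 'k) set"
    where "A = {\<phi> \<in> Lip0 e. \<forall>u\<in>N. \<forall>v\<in>N. \<phi> u = \<phi> v}"
  define S where "S = {\<Phi> \<in> lip_free e. \<forall>\<phi>\<in>A. \<Phi> \<phi> = 0}"
  have A: "A \<subseteq> Lip0 e" by (auto simp: A_def)
  have diff_in: "eval_at e u - eval_at e v \<in> (lip_free e :: (('a \<Rightarrow> 'k) \<Rightarrow> 'k) set)" for u v
    by (intro fun_space.subspace_diff[OF lip_free_subspace] eval_at_in_lip_free)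
  have subspace: "fun_space.subspace S"
    unfolding S_def fun_space.subspace_def
    using lip_free_subspace[of e, where 'b = 'k] by (auto simp: fun_space.subspace_def)
  have "S = {\<Phi> \<in> Lip0_dual e. \<forall>\<phi>\<in>A. \<Phi> \<phi> = 0} \<inter> lip_free e"
    using lip_free_subset by (auto simp: S_def)
  then have closed: "closedin (subtopology (dual_topology e) (lip_free e)) S"
    unfolding closedin_subtopology using closedin_dual_annihilator[OF A] by blast
  have nonzero: "{0} \<subset> S"
  proof -
    \<comment> \<open>The distance to \<open>y\<close> separates \<open>x\<close> from
      \<open>y\<close>: the difference of the evaluations takes the value \<open>dist x y\<close> on
      it.\<close>
    let ?\<phi> = "\<lambda>u. of_real (dist u y) - of_real (dist e y) :: 'k"
    have \<phi>: "?\<phi> \<in> Lip0 e"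
      by (rule of_real_nonexpansive_in_Lip0) (metis abs_dist_diff_le dist_commute)
    have "eval_at e x - eval_at e y \<in> S"
      unfolding S_def
    proof (intro CollectI conjI diff_in ballI)
      fix \<phi> assume \<phi>: "\<phi> \<in> A"
      then have "\<phi> x = \<phi> y" using N(2,3) unfolding A_def by blast
      with \<phi> A show "(eval_at e x - eval_at e y) \<phi> = 0"
        by (simp add: eval_at_def)
    qed
    moreover have "(eval_at e x - eval_at e y) ?\<phi> \<noteq> 0"
      using N(4) by (simp add: eval_at_def \<phi>)
    then have "eval_at e x - eval_at e y \<noteq> (0 :: ('a \<Rightarrow> 'k) \<Rightarrow> 'k)"
      by (metis zero_fun_apply)
    ultimately show ?thesis
      using fun_space.subspace_0[OF subspace] by blast
  qed
  have proper: "S \<subset> lip_free e"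
  proof -
    \<comment> \<open>The distance to \<open>N\<close> is constant on \<open>N\<close> and positive
      at \<open>r\<close>, so the evaluations at \<open>r\<close> and \<open>x\<close> differ on a
      member of \<open>A\<close>.\<close>
    let ?\<phi> = "\<lambda>u. of_real (infdist u N) - of_real (infdist e N) :: 'k"
    have \<phi>: "?\<phi> \<in> Lip0 e"
      by (rule of_real_nonexpansive_in_Lip0) (rule infdist_triangle_abs)
    then have "?\<phi> \<in> A" by (simp add: A_def)
    moreover have "(eval_at e r - eval_at e x) ?\<phi> \<noteq> 0"
      using r N(2) by (simp add: eval_at_def \<phi>)
    ultimately have "eval_at e r - eval_at e x \<notin> S" unfolding S_def by blast
    moreover have "S \<subseteq> lip_free e" by (auto simp: S_def)
    ultimately show ?thesis using diff_in by blast
  qed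
  have invariant: "lip_free_op f e ` S \<subseteq> S"
  proof clarify
    fix \<Phi> assume \<Phi>: "\<Phi> \<in> S"
    then have F: "\<Phi> \<in> lip_free e" by (simp add: S_def)
    \<comment> \<open>Invariance dualizes: since \<open>f\<close> maps \<open>N\<close> into
      \<open>N\<close>, composing with \<open>f\<close> and subtracting a constant keeps a function
      constant on \<open>N\<close>.\<close>
    have "pullback f e \<phi> \<in> A" if "\<phi> \<in> A" for \<phi>
      unfolding A_def
    proof (intro CollectI conjI ballI)
      show "pullback f e \<phi> \<in> Lip0 e" using that A pullback_in_Lip0(1)[OF L] by blast
      fix u v assume "u \<in> N" "v \<in> N"
      with that N(1) have "\<phi> (f u) = \<phi> (f v)" unfolding A_def by blast
      then show "pullback f e \<phi> u = pullback f e \<phi> v" by (simp add: pullback_def)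
    qed
    then have "adjoint_pullback f e \<Phi> \<phi> = 0" if "\<phi> \<in> A" for \<phi>
      using that \<Phi> by (auto simp: S_def adjoint_pullback_def)
    then show "lip_free_op f e \<Phi> \<in> S"
      using adjoint_pullback_lip_free[OF L F]
      by (simp add: S_def lip_free_op_eq_adjoint_pullback[OF L F])
  qed
  show ?thesis
    using subspace closed nonzero proper invariant
    unfolding nontrivial_invariant_subspace_def by blast
qed

theorem lemma4p1:
  fixes f :: "'a::metric_space \<Rightarrow> 'a" and e :: 'a
  assumes "infinite (UNIV :: 'a set)"
    and "\<exists>p :: 'a. p isolated_in UNIV"
    and "\<exists>L. L-lipschitz_on UNIV f"
  shows "(\<exists>S :: (('a \<Rightarrow> real) \<Rightarrow> real) set.
            nontrivial_invariant_subspace e (lip_free_op f e) S) \<and>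
         (\<exists>S :: (('a \<Rightarrow> complex) \<Rightarrow> complex) set.
            nontrivial_invariant_subspace e (lip_free_op f e) S)"
proof -
  obtain N x y r where N: "f ` N \<subseteq> N" "x \<in> N" "y \<in> N" "x \<noteq> y" "infdist r N > 0"
    using ex_invariant_nondense[OF assms(1)] assms(2) by meson
  obtain L where "L-lipschitz_on UNIV f" using assms(3) by blast
  \<comment> \<open>The set \<open>N\<close> does not depend on the scalars, so it serves both
    fields.\<close>
  then show ?thesis by (intro conjI nontrivial_invariant_subspaceI[OF _ N])
qed

end
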